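(* Let $n\ge2$, $m\ge2$, and let $\varepsilon:\{0,\dots,m-1\}^{n-1}\to\{0,\dots,m-1\}^{n-1}$ be an embedding of $S(n-1,m)$ into $K_m^{n-1}$. Let $\pi_0,\pi_1,\dots,\pi_{m-1},\pi_m$ be permutations of $\{0,\dots,m-1\}$ such that $\pi_i(j)=\pi_j(i)$ for all $i,j\in\{0,\dots,m-1\}$. Define $\varepsilon':\{0,\dots,m-1\}^n\to\{0,\dots,m-1\}^n$ by $$\varepsilon'(i,w_1,\dots,w_{n-1})=\bigl(\pi_m(i),\ \varepsilon(\pi_i(w_1),\dots,\pi_i(w_{n-1}))\bigr).$$ Then $\varepsilon'$ is an embedding of $S(n,m)$ into $K_m^n$.
   Context: For $n\ge1$, $m\ge2$, the Sierpinski graph $S(n,m)$ has vertex set $\{0,1,\dots,m-1\}^n$, and two distinct vertices $u,v$ are adjacent iff there exists $h\in\{1,\dots,n\}$ such that: $u_i=v_i$ for $i<h$; $u_h\neq v_h$; and $u_j=v_h$, $v_j=u_h$ for all $j>h$. The Hamming graph $K_m^n$ has vertex set $\{0,1,\dots,m-1\}^n$, two vertices adjacent iff they differ in exactly one coordinate. An embedding of a graph $G$ into a graph $H$ is an injective map $V(G)\to V(H)$ sending every edge of $G$ to an edge of $H$ (i.e. an isomorphism of $G$ onto a subgraph of $H$). For a permutation $\pi$ of $\{0,\dots,m-1\}$, applying $\pi$ coordinatewise is an automorphism of $S(n-1,m)$. *)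

theory Defs
  imports "Graph_Theory.Pair_Digraph" "HOL-Combinatorics.Permutations"
begin

text \<open>Vertices are words over \<open>{0,\<dots>,m-1}\<close> of length \<open>n\<close>, represented as lists, so the coordinate
  \<open>u\<^sub>i\<close> (counted from 1) is \<open>u ! (i - 1)\<close>. An undirected edge is represented by the two arcs between
  its end vertices.\<close>

definition words :: "nat \<Rightarrow> nat \<Rightarrow> nat list set" where
  "words n m = {w. length w = n \<and> set w \<subseteq> {..<m}}"

definition sierpinski_graph :: "nat \<Rightarrow> nat \<Rightarrow> nat list pair_pre_digraph" where
  "sierpinski_graph n m =
    \<lparr> pverts = words n m,
      parcs = {(u, v). u \<in> words n m \<and> v \<in> words n m \<and> u \<noteq> v \<and>
        (\<exists>h<n. (\<forall>i<h. u ! i = v ! i) \<and> u ! h \<noteq> v ! h \<and>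
          (\<forall>j. h < j \<and> j < n \<longrightarrow> u ! j = v ! h \<and> v ! j = u ! h))} \<rparr>"

definition hamming_graph :: "nat \<Rightarrow> nat \<Rightarrow> nat list pair_pre_digraph" where
  "hamming_graph n m =
    \<lparr> pverts = words n m,
      parcs = {(u, v). u \<in> words n m \<and> v \<in> words n m \<and> card {i. i < n \<and> u ! i \<noteq> v ! i} = 1} \<rparr>"

definition graph_embedding ::
  "('a \<Rightarrow> 'b) \<Rightarrow> 'a pair_pre_digraph \<Rightarrow> 'b pair_pre_digraph \<Rightarrow> bool" where
  "graph_embedding f G H \<longleftrightarrow>
    f \<in> pverts G \<rightarrow> pverts H \<and> inj_on f (pverts G) \<and>
    (\<forall>(u, v) \<in> parcs G. (f u, f v) \<in> parcs H)"

lemma finite_words: "finite (words n m)"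
proof -
  have "words n m = {w. set w \<subseteq> {..<m} \<and> length w = n}"
    by (auto simp: words_def)
  then show ?thesis
    by (simp add: finite_lists_length_eq)
qed

lemma pair_graphI:
  assumes "finite V" and "\<And>u v. (u, v) \<in> E \<Longrightarrow> u \<in> V \<and> v \<in> V \<and> u \<noteq> v \<and> (v, u) \<in> E"
  shows "pair_graph \<lparr> pverts = V, parcs = E \<rparr>"
proof -
  have "E \<subseteq> V \<times> V"
    using assms(2) by auto
  then have "finite E"
    using assms(1) finite_subset by blast
  then show ?thesis
    using assms by unfold_locales (auto simp: symmetric_def sym_def dest: assms(2))
qed

lemma pair_graph_sierpinski: "pair_graph (sierpinski_graph n m)"
  unfolding sierpinski_graph_def
  by (rule pair_graphI[OF finite_words]) (simp, metis)

lemma pair_graph_hamming: "pair_graph (hamming_graph n m)"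
  unfolding hamming_graph_def
  by (rule pair_graphI[OF finite_words]) (auto simp: eq_commute)

end

theory Submission
  imports Defs
begin

text \<open>An edge of \<open>S(n,m)\<close> either lies inside a copy \<open>iS(n-1,m)\<close>, where the coordinatewise
  permutation is an automorphism and \<open>\<epsilon>\<close> preserves the edge, or joins \<open>ij\<dots>j\<close> to \<open>ji\<dots>i\<close>. In the
  latter case the symmetry \<open>\<pi>\<^sub>i(j) = \<pi>\<^sub>j(i)\<close> makes \<open>\<epsilon>\<close> act on the same constant word at both ends,
  so that the images differ in the first coordinate only.\<close>

lemma Cons_in_words [simp]: "x # w \<in> words (Suc n) m \<longleftrightarrow> x < m \<and> w \<in> words n m"
  by (auto simp: words_def)

lemma words_SucE:
  assumes "u \<in> words (Suc n) m"
  obtains x w where "u = x # w" "x < m" "w \<in> words n m"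
proof (cases u)
  case Nil
  with assms show thesis by (simp add: words_def)
next
  case (Cons x w)
  with assms that show thesis by simp
qed

lemma map_permutes_in_words:
  assumes "p permutes {..<m}" "w \<in> words n m"
  shows "map p w \<in> words n m"
  using assms(2) permutes_in_image[OF assms(1)] by (auto simp: words_def)

text \<open>Injectivity of \<open>p\<close> preserves both equality and inequality of letters, so
  the same position \<open>h\<close> witnesses the image arc.\<close>

lemma sierpinski_arc_map_permutes:
  assumes p: "p permutes {..<m}" and uv: "(u, v) \<in> parcs (sierpinski_graph n m)"
  shows "(map p u, map p v) \<in> parcs (sierpinski_graph n m)"
proof -
  \<comment> \<open>Since \<open>p\<close> fixes everything outside \<open>{..<m}\<close>, it is
    injective on all naturals, so letters can be compared without tracking that they lie below
    \<open>m\<close>.\<close>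
  have inj: "inj p"
    using p by (rule permutes_inj)
  from uv obtain h where w: "u \<in> words n m" "v \<in> words n m" "u \<noteq> v"
    and h: "h < n" "\<forall>i<h. u ! i = v ! i" "u ! h \<noteq> v ! h"
      "\<forall>j. h < j \<and> j < n \<longrightarrow> u ! j = v ! h \<and> v ! j = u ! h"
    by (auto simp: sierpinski_graph_def)
  have len: "length u = n" "length v = n"
    using w by (auto simp: words_def)
  have "\<forall>i<h. map p u ! i = map p v ! i" "map p u ! h \<noteq> map p v ! h"
    "\<forall>j. h < j \<and> j < n \<longrightarrow> map p u ! j = map p v ! h \<and> map p v ! j = map p u ! h"
    using h len by (auto simp: inj_eq[OF inj])
  moreover have "map p u \<noteq> map p v"
    using w inj by (simp add: inj_map_eq_map)
  ultimately show ?thesis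
    using w h(1) map_permutes_in_words[OF p] by (auto simp: sierpinski_graph_def)
qed

text \<open>The split is on the first position \<open>h\<close> where the words differ:
  \<open>h = 0\<close> forces both tails to be constant, while \<open>h > 0\<close> makes the heads
  agree and leaves the whole pattern in the tails.\<close>

lemma sierpinski_arc_ConsE:
  assumes "(i # u, j # v) \<in> parcs (sierpinski_graph (Suc n) m)"
  obtains (inner) "i = j" "(u, v) \<in> parcs (sierpinski_graph n m)"
    | (bridge) "i \<noteq> j" "u = replicate n j" "v = replicate n i"
proof -
  from assms obtain h where w: "u \<in> words n m" "v \<in> words n m" "i # u \<noteq> j # v"
    and h: "h < Suc n" "\<forall>k<h. (i # u) ! k = (j # v) ! k" "(i # u) ! h \<noteq> (j # v) ! h"
      "\<forall>k. h < k \<and> k < Suc n \<longrightarrow> (i # u) ! k = (j # v) ! h \<and> (j # v) ! k = (i # u) ! h"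
    by (auto simp: sierpinski_graph_def)
  show thesis
  proof (cases h)
    case 0
    have "u ! k = j \<and> v ! k = i" if "k < n" for k
      using h(4)[rule_format, of "Suc k"] that 0 by simp
    then have "u = replicate n j" "v = replicate n i"
      using w by (auto simp: words_def intro!: nth_equalityI)
    with bridge h(3) 0 show thesis by simp
  next
    case (Suc g)
    have "i = j"
      using h(2)[rule_format, of 0] Suc by simp
    moreover have "u ! k = v ! k" if "k < g" for k
      using h(2)[rule_format, of "Suc k"] that Suc by simp
    moreover have "u ! k = v ! g \<and> v ! k = u ! g" if "g < k" "k < n" for k
      using h(4)[rule_format, of "Suc k"] that Suc by simp
    \<comment> \<open>Dropping the common head shifts positions by one, so the witness is now
      \<open>g\<close>, where \<open>h = Suc g\<close>; the tails differ because the heads do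
      not.\<close>
    ultimately have "(u, v) \<in> parcs (sierpinski_graph n m)"
      using w h Suc by (auto simp: sierpinski_graph_def)
    with inner \<open>i = j\<close> show thesis by simp
  qed
qed

text \<open>Tail positions move up by one and the head occupies position 0. As \<open>Suc\<close> is
  injective, the Hamming distance is that of the tails, plus one if the heads differ.\<close>

lemma differing_positions_Cons:
  "{k. k < Suc n \<and> (x # u) ! k \<noteq> (y # v) ! k} =
    (if x = y then {} else {0}) \<union> Suc ` {k. k < n \<and> u ! k \<noteq> v ! k}"
  (is "?L = ?R")
proof (rule set_eqI)
  fix k
  show "k \<in> ?L \<longleftrightarrow> k \<in> ?R"
    by (cases k) auto
qed

lemma hamming_arc_Cons_same:
  assumes "x < m" "(u, v) \<in> parcs (hamming_graph n m)"
  shows "(x # u, x # v) \<in> parcs (hamming_graph (Suc n) m)"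
  using assms by (simp add: hamming_graph_def differing_positions_Cons card_image)

lemma hamming_arc_Cons_diff:
  assumes "x < m" "y < m" "x \<noteq> y" "u \<in> words n m"
  shows "(x # u, y # u) \<in> parcs (hamming_graph (Suc n) m)"
  using assms by (simp add: hamming_graph_def differing_positions_Cons)

theorem theorem7:
  fixes n m :: nat
    and \<epsilon> \<epsilon>' :: "nat list \<Rightarrow> nat list"
    and \<pi> :: "nat \<Rightarrow> nat \<Rightarrow> nat"
  assumes "n \<ge> 2" and "m \<ge> 2"
    and "graph_embedding \<epsilon> (sierpinski_graph (n - 1) m) (hamming_graph (n - 1) m)"
    and "\<And>k. k \<le> m \<Longrightarrow> \<pi> k permutes {..<m}"
    and "\<And>i j. i < m \<Longrightarrow> j < m \<Longrightarrow> \<pi> i j = \<pi> j i"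
    and "\<And>i w. i < m \<Longrightarrow> w \<in> words (n - 1) m \<Longrightarrow> \<epsilon>' (i # w) = \<pi> m i # \<epsilon> (map (\<pi> i) w)"
  shows "graph_embedding \<epsilon>' (sierpinski_graph n m) (hamming_graph n m)"
proof -
  define N where "N = n - 1"
  have n: "n = Suc N"
    using assms(1) by (simp add: N_def)
  have verts: "pverts (sierpinski_graph k m) = words k m" "pverts (hamming_graph k m) = words k m"
    for k by (simp_all add: sierpinski_graph_def hamming_graph_def)
  have \<epsilon>_words: "\<epsilon> w \<in> words N m" if "w \<in> words N m" for w
    using assms(3) that by (auto simp: graph_embedding_def verts N_def)
  have \<epsilon>_inj: "inj_on \<epsilon> (words N m)"
    using assms(3) by (simp add: graph_embedding_def verts N_def)
  have \<epsilon>_arc: "(\<epsilon> u, \<epsilon> v) \<in> parcs (hamming_graph N m)"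
    if "(u, v) \<in> parcs (sierpinski_graph N m)" for u v
    using assms(3) that by (auto simp: graph_embedding_def N_def)
  have \<epsilon>': "\<epsilon>' (i # w) = \<pi> m i # \<epsilon> (map (\<pi> i) w)" if "i < m" "w \<in> words N m" for i w
    using assms(6) that by (simp add: N_def)
  have map_words: "map (\<pi> k) w \<in> words N m" if "k \<le> m" "w \<in> words N m" for k w
    using map_permutes_in_words[OF assms(4)] that by blast
  have \<pi>m_less: "\<pi> m i < m" if "i < m" for i
    using permutes_in_image[OF assms(4)[of m], of i] that by simp
  have \<pi>_inj: "inj (\<pi> k)" if "k \<le> m" for k
    using permutes_inj[OF assms(4)[OF that]] .
  have "\<epsilon>' u \<in> words n m" if "u \<in> words n m" for u
    using that unfolding n
    by (elim words_SucE) (simp add: \<epsilon>' \<epsilon>_words map_words \<pi>m_less)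
  moreover have "inj_on \<epsilon>' (words n m)"
  proof (rule inj_onI)
    fix u v
    assume "u \<in> words n m" "v \<in> words n m" and eq: "\<epsilon>' u = \<epsilon>' v"
    then obtain i u' j v' where u: "u = i # u'" "i < m" "u' \<in> words N m"
      and v: "v = j # v'" "j < m" "v' \<in> words N m"
      unfolding n by (elim words_SucE) blast
    from eq u v have "\<pi> m i = \<pi> m j" and e: "\<epsilon> (map (\<pi> i) u') = \<epsilon> (map (\<pi> j) v')"
      by (simp_all add: \<epsilon>')
    \<comment> \<open>Injectivity of \<open>\<pi> m\<close> recovers the head first; only then is it
      known that the same permutation acts on both tails, so that it can be cancelled.\<close>
    then have "i = j"
      using \<pi>_inj[of m] by (simp add: inj_eq)
    with e have "map (\<pi> i) u' = map (\<pi> i) v'"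
      using inj_onD[OF \<epsilon>_inj] map_words u v by simp
    with \<open>i = j\<close> show "u = v"
      using u v \<pi>_inj[of i] by (simp add: inj_map_eq_map)
  qed
  moreover have "(\<epsilon>' u, \<epsilon>' v) \<in> parcs (hamming_graph n m)"
    if uv: "(u, v) \<in> parcs (sierpinski_graph n m)" for u v
  proof -
    from uv have "u \<in> words n m" "v \<in> words n m"
      by (auto simp: sierpinski_graph_def)
    then obtain i u' j v' where u: "u = i # u'" "i < m" "u' \<in> words N m"
      and v: "v = j # v'" "j < m" "v' \<in> words N m"
      unfolding n by (elim words_SucE) blast
    from uv have "(i # u', j # v') \<in> parcs (sierpinski_graph (Suc N) m)"
      by (simp add: u v n)
    then show ?thesis
    proof (cases rule: sierpinski_arc_ConsE)
      \<comment> \<open>With \<open>i = j\<close>, both tails pass through the same automorphism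
        \<open>\<pi> i\<close> and then \<open>\<epsilon>\<close>, and the common head
        \<open>\<pi> m i\<close> adds no difference.\<close>
      case inner
      then have "(\<epsilon> (map (\<pi> i) u'), \<epsilon> (map (\<pi> i) v')) \<in> parcs (hamming_graph N m)"
        using \<epsilon>_arc sierpinski_arc_map_permutes[OF assms(4)[of i]] u by simp
      then show ?thesis
        using u v inner by (simp add: n \<epsilon>' hamming_arc_Cons_same \<pi>m_less)
    next
      case bridge
      \<comment> \<open>The two sides are constant words with letters \<open>\<pi> i j\<close> and
        \<open>\<pi> j i\<close>, equal by the symmetry assumption.\<close>
      have "map (\<pi> i) u' = map (\<pi> j) v'"
        using bridge assms(5) u v by simp
      moreover have "\<pi> m i \<noteq> \<pi> m j"
        using bridge \<pi>_inj[of m] by (simp add: inj_eq)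
      ultimately show ?thesis
        using u v by (simp add: n \<epsilon>' hamming_arc_Cons_diff \<pi>m_less \<epsilon>_words map_words)
    qed
  qed
  ultimately show ?thesis
    by (auto simp: graph_embedding_def verts)
qed

end
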